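(* Let $\mathbf{Z}$ be an $n$-dimensional random vector with i.i.d. heavy-tailed marginals, let $f$ be a ReLU neural network on $\mathbb{R}^n$ with output in $\mathbb{R}_+^m=[0,\infty)^m$, and let $\mathbf{X}=f(\mathbf{Z})$, where $\mathbf{X}$ is heavy-tailed (multivariate regularly varying) with the same shape parameter as $\mathbf{Z}$ and has angular measure $\mathbf{S}_{\mathbf{X}}$. Then $\mathbf{S}_{\mathbf{X}}$ is concentrated on a finite set of at most $n$ points of the simplex: there exist vectors $\mathbf{v}_1,\dots,\mathbf{v}_{n'}$ with $n'\le n$ such that, for any subset $\mathbb{A}$ of the $(m-1)$-dimensional simplex, $$\mathbf{S}_{\mathbf{X}}(\mathbb{A})=\sum_{i=1}^{n'}p_i\,\delta_{\mathbf{v}_i}(\mathbb{A}),$$ where $\delta_{\mathbf{v}}$ is the Dirac measure at $\mathbf{v}$ and the $p_i>0$ satisfy $\sum_{i=1}^{n'}p_i=1$.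
   Context: ReLU neural network: a feed-forward network with linear layers and ReLU activation functions, i.e. a finite composition of maps $\mathbf{y}\mapsto \mathbf{W}\mathbf{y}+\mathbf{b}$ (weight matrix and bias) and of the componentwise activation $\mathrm{ReLU}(x)=\max(x,0)$. A real random variable $X$ is heavy-tailed with shape parameter $\xi>0$ if it is regularly varying with tail index $\alpha=1/\xi>0$, i.e. $\lim_{t\to+\infty}P(X>tx\mid X>t)=x^{-\alpha}$ for all $x\ge 1$. The $(m-1)$-dimensional simplex is $\{\mathbf{x}\in[0,\infty)^m:\sum_i x_i=1\}$. For a random vector $\mathbf{X}$ in $[0,\infty)^m$, put $R=X_1+\dots+X_m=\|\mathbf{X}\|$ and $\mathbf{\Theta}=\mathbf{X}/\|\mathbf{X}\|$. $\mathbf{X}$ is multivariate regularly varying (heavy-tailed) if (i) $R$ is regularly varying, and (ii) there is a probability measure $\mathbf{S}_{\mathbf{X}}$ on the $(m-1)$-dimensional simplex, called the angular measure of $\mathbf{X}$, such that $P(\mathbf{\Theta}\in\bullet\mid R>r)$ converges weakly to $\mathbf{S}_{\mathbf{X}}$ as $r\to\infty$. The tail index of $\mathbf{X}$ is that of $R$, and its shape parameter is the inverse of the tail index.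
   Formalization: The marginals of Z are also assumed to have negligible left tails, P(Z_i<-t)/P(Z_i>t)→0 (automatic if Z≥0); without this the bound n fails, e.g. n=1, Z symmetric Pareto, f(z)=(ReLU(z),ReLU(-z)) gives two atoms. *)

theory Defs
  imports "HOL-Probability.Probability" "Jordan_Normal_Form.Matrix"
begin

no_notation Matrix.vec_index (infixl \<open>$\<close> 100)

text \<open>The layers of a network have arbitrary widths, so the networks are built on the matrices
  and vectors of Jordan_Normal_Form, whose dimensions are natural numbers. The predicate
  \<open>relu_map n m F\<close> says that \<open>F\<close> is a network with input dimension \<open>n\<close> and output
  dimension \<open>m\<close>. Only the values of \<open>F\<close> on \<open>carrier_vec n\<close> matter.\<close>

inductive relu_map :: "nat \<Rightarrow> nat \<Rightarrow> (real Matrix.vec \<Rightarrow> real Matrix.vec) \<Rightarrow> bool" where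
  linear: "relu_map n m (\<lambda>y. W *\<^sub>v y + b)" if "W \<in> carrier_mat m n" and "b \<in> carrier_vec m"
| activation: "relu_map n n (map_vec (\<lambda>x. max x 0))"
| comp: "relu_map n m (G \<circ> F)" if "relu_map n k F" and "relu_map k m G"

text \<open>The enumeration of the index type is arbitrary, but \<open>relu_map\<close> is closed under
  permutations of the input and output coordinates, so \<open>relu_network\<close> does not depend
  on it.\<close>

definition coords :: "real ^ 'n \<Rightarrow> real Matrix.vec" where
  "coords x = Matrix.vec CARD('n) (\<lambda>i. x $ from_nat_into UNIV i)"

definition relu_network :: "(real ^ 'n \<Rightarrow> real ^ 'm) \<Rightarrow> bool" where
  "relu_network f \<longleftrightarrow>
    (\<exists>F. relu_map CARD('n) CARD('m) F \<and> (\<forall>x. coords (f x) = F (coords x)))"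

definition regularly_varying :: "'a measure \<Rightarrow> ('a \<Rightarrow> real) \<Rightarrow> real \<Rightarrow> bool" where
  "regularly_varying M X \<alpha> \<longleftrightarrow> \<alpha> > 0 \<and>
    (\<forall>x\<ge>1. ((\<lambda>t. \<P>(\<omega> in M. X \<omega> > t * x \<bar> X \<omega> > t)) \<longlongrightarrow> x powr (- \<alpha>)) at_top)"

definition heavy_tailed :: "'a measure \<Rightarrow> ('a \<Rightarrow> real) \<Rightarrow> real \<Rightarrow> bool" where
  "heavy_tailed M X \<xi> \<longleftrightarrow> \<xi> > 0 \<and> regularly_varying M X (1 / \<xi>)"

definition std_simplex :: "(real ^ 'm) set" where
  "std_simplex = {x. (\<forall>i. 0 \<le> x $ i) \<and> (\<Sum>i\<in>UNIV. x $ i) = 1}"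

definition radius :: "real ^ 'm \<Rightarrow> real" where
  "radius x = (\<Sum>i\<in>UNIV. x $ i)"

definition angle :: "real ^ 'm \<Rightarrow> real ^ 'm" where
  "angle x = (1 / radius x) *\<^sub>R x"

definition weakly_converges ::
    "('i \<Rightarrow> 'b::topological_space measure) \<Rightarrow> 'b measure \<Rightarrow> 'i filter \<Rightarrow> bool" where
  "weakly_converges \<mu> S F \<longleftrightarrow>
    (\<forall>g :: 'b \<Rightarrow> real. continuous_on UNIV g \<longrightarrow> bounded (range g) \<longrightarrow>
      ((\<lambda>r. integral\<^sup>L (\<mu> r) g) \<longlongrightarrow> integral\<^sup>L S g) F)"

text \<open>A probability measure on the simplex is rendered as a Borel probability measure on the
  whole space giving mass 1 to the simplex. As the simplex is closed, weak convergence is the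
  same in both spaces.\<close>

definition angular_measure :: "'a measure \<Rightarrow> ('a \<Rightarrow> real ^ 'm) \<Rightarrow> (real ^ 'm) measure \<Rightarrow> bool" where
  "angular_measure M X S \<longleftrightarrow>
    prob_space S \<and> sets S = sets borel \<and> measure S std_simplex = 1 \<and>
    weakly_converges
      (\<lambda>r. distr (uniform_measure M {\<omega> \<in> space M. radius (X \<omega>) > r}) borel (\<lambda>\<omega>. angle (X \<omega>)))
      S at_top"

definition mv_heavy_tailed ::
    "'a measure \<Rightarrow> ('a \<Rightarrow> real ^ 'm) \<Rightarrow> real \<Rightarrow> (real ^ 'm) measure \<Rightarrow> bool" where
  "mv_heavy_tailed M X \<xi> S \<longleftrightarrow>
    heavy_tailed M (\<lambda>\<omega>. radius (X \<omega>)) \<xi> \<and> angular_measure M X S"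

text \<open>Regular variation as defined above only constrains the right tail. This predicate says
  that the left tail is of smaller order. It holds for every nonnegative regularly varying
  variable.\<close>

definition negligible_left_tail :: "'a measure \<Rightarrow> ('a \<Rightarrow> real) \<Rightarrow> bool" where
  "negligible_left_tail M X \<longleftrightarrow>
    ((\<lambda>t. \<P>(\<omega> in M. X \<omega> < - t) / \<P>(\<omega> in M. X \<omega> > t)) \<longlongrightarrow> 0) at_top"

end

theory Submission
  imports Defs
begin

text \<open>
  Dropping all biases from the network gives a positively homogeneous Lipschitz map \<open>g\<close> at bounded
  distance from \<open>f\<close>. Two coordinates of \<open>Z\<close> exceed a multiple of \<open>r\<close> in absolute value with
  probability of order the square of the tail of \<open>Z\<close>, which is negligible against the tail of the
  radius of \<open>f Z\<close> because both tails are regularly varying with the same index. So given a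
  large radius, \<open>Z\<close> lies, up to a small relative error, on one coordinate axis, and the angle of
  \<open>f Z\<close> is close to that of \<open>g\<close> at a unit vector of a semi-axis. If some \<open>g (axis i 1)\<close> has positive
  radius, the tail of the radius is comparable to the right tail of \<open>Z\<close> and the left tails are
  negligible, so only the \<open>n\<close> positive semi-axes matter. Otherwise the positive semi-axes
  never produce a large radius, and only the \<open>n\<close> negative ones matter. A continuous function
  vanishing exactly at the \<open>n\<close> candidate angles therefore has integral zero in the limit.
\<close>

section \<open>Homogeneous approximation of ReLU networks\<close>

text \<open>The coordinates summed over are those of the first argument, so the value is meaningful
  for vectors of equal dimension only.\<close>

definition l1_vdist :: "real Matrix.vec \<Rightarrow> real Matrix.vec \<Rightarrow> real" where
  "l1_vdist x y = (\<Sum>j<dim_vec x. \<bar>vec_index x j - vec_index y j\<bar>)"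

lemma l1_vdist_triangle:
  assumes "x \<in> carrier_vec n" "y \<in> carrier_vec n" "z \<in> carrier_vec n"
  shows "l1_vdist x z \<le> l1_vdist x y + l1_vdist y z"
  using assms unfolding l1_vdist_def
  by (auto simp: sum.distrib[symmetric] intro!: sum_mono)

text \<open>The bias cancels in the difference, and bounding each coordinate difference by the whole
  distance leaves the sum of the absolute entries of \<open>W\<close> as a crude Lipschitz
  constant.\<close>

lemma l1_vdist_affine:
  assumes W: "W \<in> carrier_mat m n" and b: "b \<in> carrier_vec m"
    and x: "x \<in> carrier_vec n" and y: "y \<in> carrier_vec n"
  shows "l1_vdist (W *\<^sub>v x + b) (W *\<^sub>v y + b) \<le>
    (\<Sum>i<m. \<Sum>j<n. \<bar>W $$ (i, j)\<bar>) * l1_vdist x y"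
proof -
  have comp: "vec_index (W *\<^sub>v z + b) i = (\<Sum>j<n. W $$ (i, j) * vec_index z j) + vec_index b i"
    if "i < m" "z \<in> carrier_vec n" for z i
    using that W b by (auto simp: scalar_prod_def lessThan_atLeast0)
  have dim: "dim_vec (W *\<^sub>v x + b) = m" using b by auto
  have "l1_vdist (W *\<^sub>v x + b) (W *\<^sub>v y + b)
      = (\<Sum>i<m. \<bar>\<Sum>j<n. W $$ (i, j) * (vec_index x j - vec_index y j)\<bar>)"
    unfolding l1_vdist_def dim
    by (rule sum.cong) (simp_all add: comp x y sum_subtractf right_diff_distrib)
  also have "\<dots> \<le> (\<Sum>i<m. \<Sum>j<n. \<bar>W $$ (i, j)\<bar> * l1_vdist x y)"
  proof (intro sum_mono order_trans[OF sum_abs])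
    fix i j assume "j \<in> {..<n}"
    then have "\<bar>vec_index x j - vec_index y j\<bar> \<le> l1_vdist x y"
      unfolding l1_vdist_def using x by (intro member_le_sum) auto
    then show "\<bar>W $$ (i, j) * (vec_index x j - vec_index y j)\<bar> \<le> \<bar>W $$ (i, j)\<bar> * l1_vdist x y"
      by (simp add: abs_mult mult_left_mono)
  qed
  finally show ?thesis by (simp add: sum_distrib_right)
qed

text \<open>The approximating map is the network with all biases removed.\<close>

lemma relu_map_homogeneous_approx:
  assumes "relu_map n m F"
  shows "\<exists>F0 L D. 0 \<le> L \<and> F \<in> carrier_vec n \<rightarrow> carrier_vec m \<and> F0 \<in> carrier_vec n \<rightarrow> carrier_vec m \<and>
    (\<forall>c\<ge>0. \<forall>x\<in>carrier_vec n. F0 (c \<cdot>\<^sub>v x) = c \<cdot>\<^sub>v F0 x) \<and>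
    (\<forall>x\<in>carrier_vec n. \<forall>y\<in>carrier_vec n. l1_vdist (F x) (F y) \<le> L * l1_vdist x y) \<and>
    (\<forall>x\<in>carrier_vec n. \<forall>y\<in>carrier_vec n. l1_vdist (F0 x) (F0 y) \<le> L * l1_vdist x y) \<and>
    (\<forall>x\<in>carrier_vec n. l1_vdist (F x) (F0 x) \<le> D)"
  using assms
proof induction
  case (linear W m n b)
  \<comment> \<open>A zero bias makes the bare matrix map an instance of
    \<open>l1_vdist_affine\<close>.\<close>
  have W0: "W *\<^sub>v x + 0\<^sub>v m = W *\<^sub>v x" for x
    using linear by (intro right_zero_vec carrier_vecI) auto
  show ?case
  proof (rule exI[of _ "\<lambda>y. W *\<^sub>v y"], rule exI[of _ "\<Sum>i<m. \<Sum>j<n. \<bar>W $$ (i, j)\<bar>"],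
      rule exI[of _ "\<Sum>i<m. \<bar>vec_index b i\<bar>"], intro conjI ballI allI impI)
    fix x y :: "real Matrix.vec" assume "x \<in> carrier_vec n" "y \<in> carrier_vec n"
    then show "l1_vdist (W *\<^sub>v x) (W *\<^sub>v y) \<le> (\<Sum>i<m. \<Sum>j<n. \<bar>W $$ (i, j)\<bar>) * l1_vdist x y"
      using l1_vdist_affine[OF linear(1) zero_carrier_vec] by (simp add: W0)
  next
    fix x y :: "real Matrix.vec" assume "x \<in> carrier_vec n" "y \<in> carrier_vec n"
    then show "l1_vdist (W *\<^sub>v x + b) (W *\<^sub>v y + b) \<le> (\<Sum>i<m. \<Sum>j<n. \<bar>W $$ (i, j)\<bar>) * l1_vdist x y"
      by (rule l1_vdist_affine[OF linear])
  next
    fix c :: real and x :: "real Matrix.vec" assume "x \<in> carrier_vec n"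
    then show "W *\<^sub>v (c \<cdot>\<^sub>v x) = c \<cdot>\<^sub>v (W *\<^sub>v x)"
      using linear by (intro mult_mat_vec) auto
  next
    fix x :: "real Matrix.vec" assume "x \<in> carrier_vec n"
    then show "l1_vdist (W *\<^sub>v x + b) (W *\<^sub>v x) \<le> (\<Sum>i<m. \<bar>vec_index b i\<bar>)"
      unfolding l1_vdist_def using linear by (auto intro!: sum_mono)
  qed (use linear in \<open>auto intro!: sum_nonneg\<close>)
next
  case (activation n)
  have lip: "l1_vdist (map_vec (\<lambda>x. max x 0) x) (map_vec (\<lambda>x. max x 0) y) \<le> 1 * l1_vdist x y"
    if "x \<in> carrier_vec n" "y \<in> carrier_vec n" for x y
    unfolding l1_vdist_def using that by (auto intro!: sum_mono)
  \<comment> \<open>ReLU is itself positively homogeneous and 1-Lipschitz, so it serves as its own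
    approximation with error 0.\<close>
  show ?case
    by (rule exI[of _ "map_vec (\<lambda>x. max x 0)"], rule exI[of _ 1], rule exI[of _ 0])
      (use lip in \<open>auto simp: l1_vdist_def max_mult_distrib_left intro!: eq_vecI\<close>)
next
  case (comp n k F m G)
  from comp.IH(1) obtain F0 L D where
    F: "0 \<le> L" "F \<in> carrier_vec n \<rightarrow> carrier_vec k" "F0 \<in> carrier_vec n \<rightarrow> carrier_vec k"
      "\<And>c x. c \<ge> 0 \<Longrightarrow> x \<in> carrier_vec n \<Longrightarrow> F0 (c \<cdot>\<^sub>v x) = c \<cdot>\<^sub>v F0 x"
      "\<And>x y. x \<in> carrier_vec n \<Longrightarrow> y \<in> carrier_vec n \<Longrightarrow> l1_vdist (F x) (F y) \<le> L * l1_vdist x y"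
      "\<And>x y. x \<in> carrier_vec n \<Longrightarrow> y \<in> carrier_vec n \<Longrightarrow> l1_vdist (F0 x) (F0 y) \<le> L * l1_vdist x y"
      "\<And>x. x \<in> carrier_vec n \<Longrightarrow> l1_vdist (F x) (F0 x) \<le> D"
    by blast
  from comp.IH(2) obtain G0 L' D' where
    G: "0 \<le> L'" "G \<in> carrier_vec k \<rightarrow> carrier_vec m" "G0 \<in> carrier_vec k \<rightarrow> carrier_vec m"
      "\<And>c x. c \<ge> 0 \<Longrightarrow> x \<in> carrier_vec k \<Longrightarrow> G0 (c \<cdot>\<^sub>v x) = c \<cdot>\<^sub>v G0 x"
      "\<And>x y. x \<in> carrier_vec k \<Longrightarrow> y \<in> carrier_vec k \<Longrightarrow> l1_vdist (G x) (G y) \<le> L' * l1_vdist x y"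
      "\<And>x y. x \<in> carrier_vec k \<Longrightarrow> y \<in> carrier_vec k \<Longrightarrow> l1_vdist (G0 x) (G0 y) \<le> L' * l1_vdist x y"
      "\<And>x. x \<in> carrier_vec k \<Longrightarrow> l1_vdist (G x) (G0 x) \<le> D'"
    by blast
  have Fc: "F x \<in> carrier_vec k" "F0 x \<in> carrier_vec k" if "x \<in> carrier_vec n" for x
    using F(2,3) that by auto
  have Gc: "G x \<in> carrier_vec m" "G0 x \<in> carrier_vec m" if "x \<in> carrier_vec k" for x
    using G(2,3) that by auto
  show ?case
  proof (rule exI[of _ "G0 \<circ> F0"], rule exI[of _ "L' * L"], rule exI[of _ "D' + L' * D"],
      intro conjI ballI allI impI)
    fix x y :: "real Matrix.vec" assume xy: "x \<in> carrier_vec n" "y \<in> carrier_vec n"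
    have "l1_vdist (G (F x)) (G (F y)) \<le> L' * l1_vdist (F x) (F y)" using xy G(5) Fc by blast
    also have "\<dots> \<le> L' * (L * l1_vdist x y)" using xy F(5) G(1) by (intro mult_left_mono) auto
    finally show "l1_vdist ((G \<circ> F) x) ((G \<circ> F) y) \<le> L' * L * l1_vdist x y" by (simp add: mult.assoc)
    have "l1_vdist (G0 (F0 x)) (G0 (F0 y)) \<le> L' * l1_vdist (F0 x) (F0 y)" using xy G(6) Fc by blast
    also have "\<dots> \<le> L' * (L * l1_vdist x y)" using xy F(6) G(1) by (intro mult_left_mono) auto
    finally show "l1_vdist ((G0 \<circ> F0) x) ((G0 \<circ> F0) y) \<le> L' * L * l1_vdist x y" by (simp add: mult.assoc)
  next
    fix x :: "real Matrix.vec" assume x: "x \<in> carrier_vec n"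
    \<comment> \<open>Passing through \<open>G0 (F x)\<close> costs \<open>D'\<close> for the change
      of the outer map, plus the inner error \<open>D\<close> enlarged by the Lipschitz constant of
      \<open>G0\<close>. This is why a Lipschitz bound is carried along in the induction.\<close>
    have "l1_vdist (G (F x)) (G0 (F0 x)) \<le> l1_vdist (G (F x)) (G0 (F x)) + l1_vdist (G0 (F x)) (G0 (F0 x))"
      using x Fc Gc by (intro l1_vdist_triangle) blast+
    also have "\<dots> \<le> D' + L' * l1_vdist (F x) (F0 x)"
      using x Fc G(6,7) by (intro add_mono) blast+
    also have "\<dots> \<le> D' + L' * D"
      using x F(7) G(1) by (intro add_left_mono mult_left_mono) auto
    finally show "l1_vdist ((G \<circ> F) x) ((G0 \<circ> F0) x) \<le> D' + L' * D" by simp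
  qed (use F(1,4) G(1,4) Fc Gc in auto)
qed

section \<open>Transfer to Euclidean coordinate vectors\<close>

definition l1 :: "real ^ 'n \<Rightarrow> real" where
  "l1 x = (\<Sum>i\<in>UNIV. \<bar>x $ i\<bar>)"

lemma abs_radius_le_l1: "\<bar>radius x\<bar> \<le> l1 x"
  unfolding radius_def l1_def by (rule sum_abs)

lemma norm_le_l1: "norm x \<le> l1 x"
  unfolding l1_def by (rule norm_le_l1_cart)

lemma l1_triangle: "l1 (x + y) \<le> l1 x + l1 y"
  unfolding l1_def by (auto simp: sum.distrib[symmetric] intro!: sum_mono)

lemma l1_le_norm: "l1 (x :: real ^ 'n) \<le> CARD('n) * norm x"
proof -
  have "l1 x \<le> (\<Sum>i\<in>(UNIV :: 'n set). norm x)"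
    unfolding l1_def by (intro sum_mono component_le_norm_cart)
  then show ?thesis by simp
qed

lemma bij_from_nat_into_UNIV:
  "bij_betw (from_nat_into (UNIV :: 'n set)) {..<CARD('n::finite)} UNIV"
  by (rule bij_betw_from_nat_into_finite) simp

lemma coords_carrier: "coords (x :: real ^ 'n) \<in> carrier_vec CARD('n)"
  by (simp add: coords_def)

lemma l1_vdist_coords: "l1_vdist (coords (x :: real ^ 'n)) (coords y) = l1 (x - y)"
proof -
  have "l1_vdist (coords x) (coords y) =
      (\<Sum>j<CARD('n). \<bar>(x - y) $ from_nat_into UNIV j\<bar>)"
    by (simp add: l1_vdist_def coords_def)
  also have "\<dots> = l1 (x - y)"
    unfolding l1_def by (rule sum.reindex_bij_betw[OF bij_from_nat_into_UNIV])
  finally show ?thesis .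
qed

lemma coords_scaleR: "coords (c *\<^sub>R x) = c \<cdot>\<^sub>v coords x"
  by (auto simp: coords_def)

lemma coords_inj: "coords (x :: real ^ 'n) = coords y \<Longrightarrow> x = y"
proof -
  assume "coords x = coords y"
  then have "l1_vdist (coords x) (coords y) = 0" by (simp add: l1_vdist_def)
  then have "norm (x - y) \<le> 0" using norm_le_l1[of "x - y"] by (simp add: l1_vdist_coords)
  then show "x = y" by simp
qed

text \<open>Allows maps between carrier vectors to be pulled back along \<open>coords\<close>; the
  witness undoes the enumeration of the index type.\<close>

lemma coords_surj:
  assumes "v \<in> carrier_vec CARD('n)"
  shows "\<exists>x :: real ^ 'n. coords x = v"
proof -
  let ?h = "the_inv_into {..<CARD('n)} (from_nat_into (UNIV :: 'n set))"
  have "coords (\<chi> i. vec_index v (?h i) :: real ^ 'n) = v"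
    using assms bij_from_nat_into_UNIV[where 'n='n]
    by (intro eq_vecI) (auto simp: coords_def the_inv_into_f_f bij_betw_def)
  then show ?thesis by blast
qed

text \<open>\<open>coords\<close> is a bijection onto the carrier that commutes with scaling and
  turns \<open>l1_vdist\<close> into \<open>l1\<close> of the difference, so the bias-free network
  carries over with the same constants \<open>L\<close> and \<open>D\<close>.\<close>

lemma relu_network_homogeneous_approx:
  fixes f :: "real ^ 'n \<Rightarrow> real ^ 'm"
  assumes "relu_network f"
  obtains g :: "real ^ 'n \<Rightarrow> real ^ 'm" and L D
  where "0 \<le> L" "\<And>c x. c \<ge> 0 \<Longrightarrow> g (c *\<^sub>R x) = c *\<^sub>R g x"
    "\<And>x y. l1 (f x - f y) \<le> L * l1 (x - y)" "\<And>x y. l1 (g x - g y) \<le> L * l1 (x - y)"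
    "\<And>x. l1 (f x - g x) \<le> D"
proof -
  obtain F where F: "relu_map CARD('n) CARD('m) F" and f: "\<And>x. coords (f x) = F (coords x)"
    using assms unfolding relu_network_def by blast
  from relu_map_homogeneous_approx[OF F] obtain F0 L D where
    a: "0 \<le> L" "F0 \<in> carrier_vec CARD('n) \<rightarrow> carrier_vec CARD('m)"
      "\<And>c x. c \<ge> 0 \<Longrightarrow> x \<in> carrier_vec CARD('n) \<Longrightarrow> F0 (c \<cdot>\<^sub>v x) = c \<cdot>\<^sub>v F0 x"
      "\<And>x y. x \<in> carrier_vec CARD('n) \<Longrightarrow> y \<in> carrier_vec CARD('n) \<Longrightarrow>
        l1_vdist (F x) (F y) \<le> L * l1_vdist x y"
      "\<And>x y. x \<in> carrier_vec CARD('n) \<Longrightarrow> y \<in> carrier_vec CARD('n) \<Longrightarrow>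
        l1_vdist (F0 x) (F0 y) \<le> L * l1_vdist x y"
      "\<And>x. x \<in> carrier_vec CARD('n) \<Longrightarrow> l1_vdist (F x) (F0 x) \<le> D"
    by blast
  have "\<exists>y :: real ^ 'm. coords y = F0 (coords x)" for x :: "real ^ 'n"
    using a(2) coords_carrier[of x] by (intro coords_surj) auto
  then obtain g :: "real ^ 'n \<Rightarrow> real ^ 'm" where g: "\<And>x. coords (g x) = F0 (coords x)"
    by metis
  show ?thesis
  proof (rule that[of L g D])
    show "g (c *\<^sub>R x) = c *\<^sub>R g x" if "c \<ge> 0" for c x
      using a(3)[OF that coords_carrier] by (intro coords_inj) (simp add: g coords_scaleR)
  qed (use a(1) a(4,5)[OF coords_carrier coords_carrier] a(6)[OF coords_carrier] in \<open>simp_all add: coords_carrier flip: l1_vdist_coords f g\<close>)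
qed

text \<open>The approximation lemma already supplies a Lipschitz bound in \<open>l1\<close>, which
  is equivalent to the Euclidean norm. Continuity makes the network measurable.\<close>

lemma relu_network_continuous:
  fixes f :: "real ^ 'n \<Rightarrow> real ^ 'm"
  assumes "relu_network f"
  shows "continuous_on UNIV f"
proof -
  from assms obtain L where L: "0 \<le> L" "\<And>x y. l1 (f x - f y) \<le> L * l1 (x - y)"
    by (rule relu_network_homogeneous_approx) blast
  have "(L * CARD('n))-lipschitz_on UNIV f"
  proof (rule lipschitz_onI)
    fix x y
    have "dist (f x) (f y) \<le> L * l1 (x - y)"
      unfolding dist_norm using norm_le_l1 L(2) order_trans by blast
    also have "\<dots> \<le> L * (CARD('n) * norm (x - y))"
      using L(1) l1_le_norm by (intro mult_left_mono)
    finally show "dist (f x) (f y) \<le> L * CARD('n) * dist x y" by (simp add: dist_norm)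
  qed (use L in simp)
  then show ?thesis by (rule lipschitz_on_continuous_on)
qed

section \<open>Angles of network outputs near the images of the semi-axes\<close>

lemma angle_near:
  assumes err: "l1 (x - a *\<^sub>R w) \<le> \<kappa> * r" and R: "radius x > r" "r > 0"
    and a: "a \<ge> 0" and \<kappa>: "\<kappa> < 1"
  shows "radius w > 0" and "dist (angle x) (angle w) \<le> \<kappa> * (1 + norm w / radius w)"
proof -
  define e where "e = x - a *\<^sub>R w"
  have k0: "0 \<le> \<kappa>"
    using err norm_le_l1[of "x - a *\<^sub>R w"] R
    by (metis norm_ge_zero order_trans zero_le_mult_iff not_less order.strict_iff_order)
  \<comment> \<open>\<open>radius\<close> is linear, so the radius of \<open>x\<close> splits. As
    the error part stays below \<open>r\<close>, the share of \<open>a *\<^sub>R w\<close> must be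
    positive.\<close>
  have rx: "radius x = a * radius w + radius e"
    unfolding e_def radius_def by (simp add: sum_subtractf sum_distrib_left)
  have re: "\<bar>radius e\<bar> \<le> \<kappa> * r" using abs_radius_le_l1[of e] err unfolding e_def by linarith
  have ne: "norm e \<le> \<kappa> * r" using norm_le_l1[of e] err unfolding e_def by linarith
  have "\<kappa> * r < r" using \<kappa> R by simp
  then have "a * radius w > 0" using rx re R by linarith
  then show w: "radius w > 0" using a by (simp add: zero_less_mult_iff)
  have Rp: "radius x > 0" using R by simp
  \<comment> \<open>After multiplication by \<open>radius x\<close> the multiples of
    \<open>w\<close> coming from \<open>a\<close> cancel, and only terms of the size of the error
    \<open>e\<close> remain.\<close>
  have "radius x *\<^sub>R (angle x - angle w) = x - (radius x / radius w) *\<^sub>R w"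
    using Rp by (simp add: angle_def scaleR_diff_right)
  also have "\<dots> = e - (radius e / radius w) *\<^sub>R w"
    using w by (simp add: e_def rx add_divide_distrib scaleR_add_left)
  finally have "radius x * dist (angle x) (angle w) = norm (e - (radius e / radius w) *\<^sub>R w)"
    using Rp unfolding dist_norm by (metis norm_scaleR abs_of_pos)
  also have "\<dots> \<le> norm e + \<bar>radius e\<bar> * (norm w / radius w)"
    using norm_triangle_ineq4[of e "(radius e / radius w) *\<^sub>R w"] w by simp
  also have "\<dots> \<le> \<kappa> * r + \<kappa> * r * (norm w / radius w)"
    using ne re w by (intro add_mono mult_right_mono) auto
  also have "\<dots> = r * (\<kappa> * (1 + norm w / radius w))" by (simp add: algebra_simps)
  also have "\<dots> \<le> radius x * (\<kappa> * (1 + norm w / radius w))"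
    using R k0 w by (intro mult_right_mono mult_nonneg_nonneg) auto
  finally show "dist (angle x) (angle w) \<le> \<kappa> * (1 + norm w / radius w)"
    using Rp by simp
qed

text \<open>In each coordinate \<open>z\<close> differs by at most \<delta> from a multiple of the
  signed unit vector; the maximum takes care of values of \<open>s * z $ i\<close> between -\<delta>
  and 0. The Lipschitz bound and the homogeneity of \<open>g\<close> carry this over, and
  \<open>D\<close> pays for the biases.\<close>

lemma single_large_coordinate:
  fixes f g :: "real ^ 'n \<Rightarrow> real ^ 'm" and \<delta> :: real
  assumes L: "0 \<le> L" and hom: "\<And>c x. c \<ge> 0 \<Longrightarrow> g (c *\<^sub>R x) = c *\<^sub>R g x"
    and lip: "\<And>x y. l1 (g x - g y) \<le> L * l1 (x - y)" and D: "\<And>x. l1 (f x - g x) \<le> D"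
    and s: "s = 1 \<or> s = -1" and zi: "s * z $ i \<ge> - \<delta>" and zj: "\<And>j. j \<noteq> i \<Longrightarrow> \<bar>z $ j\<bar> \<le> \<delta>"
    and \<delta>: "0 \<le> \<delta>"
  shows "l1 (f z - max (s * z $ i) 0 *\<^sub>R g (s *\<^sub>R axis i 1)) \<le> D + L * (CARD('n) * \<delta>)"
proof -
  define a where "a = max (s * z $ i) 0"
  have a0: "a \<ge> 0" by (simp add: a_def)
  have "l1 (z - a *\<^sub>R s *\<^sub>R axis i 1) \<le> (\<Sum>j\<in>(UNIV :: 'n set). \<delta>)"
    unfolding l1_def
  proof (rule sum_mono)
    fix j
    show "\<bar>(z - a *\<^sub>R s *\<^sub>R axis i 1) $ j\<bar> \<le> \<delta>"
      using s zi zj[of j] \<delta> by (cases "j = i") (auto simp: a_def axis_def max_def)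
  qed
  then have "L * l1 (z - a *\<^sub>R s *\<^sub>R axis i 1) \<le> L * (CARD('n) * \<delta>)"
    using L by (intro mult_left_mono) auto
  then have "l1 (g z - a *\<^sub>R g (s *\<^sub>R axis i 1)) \<le> L * (CARD('n) * \<delta>)"
    using lip[of z "a *\<^sub>R s *\<^sub>R axis i 1"] unfolding hom[OF a0] by (rule order_trans[rotated])
  then show ?thesis
    using l1_triangle[of "f z - g z" "g z - a *\<^sub>R g (s *\<^sub>R axis i 1)"] D[of z]
    by (simp add: a_def)
qed

text \<open>With at most one large coordinate, \<open>z\<close> is close to a semi-axis on the scale
  of \<open>r\<close>, hence \<open>f z\<close> is close to a multiple of \<open>g\<close> at its
  unit vector. For \<sigma> = 1 the lower bound on the coordinates selects the positive semi-axes;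
  for \<sigma> = -1 the large radius itself rules them out.\<close>

lemma angle_near_axis_image:
  fixes f g :: "real ^ 'n \<Rightarrow> real ^ 'm"
  assumes L: "0 \<le> L" and hom: "\<And>c x. c \<ge> 0 \<Longrightarrow> g (c *\<^sub>R x) = c *\<^sub>R g x"
    and lip: "\<And>x y. l1 (g x - g y) \<le> L * l1 (x - y)" and D: "\<And>x. l1 (f x - g x) \<le> D"
    and \<sigma>: "\<sigma> = 1 \<or> \<sigma> = -1 \<and> (\<forall>i. radius (g (axis i 1)) \<le> 0)" and \<eta>: "\<eta> > 0"
  shows "\<exists>\<epsilon> r0. 0 < \<epsilon> \<and> \<epsilon> \<le> 1 \<and> 0 < r0 \<and> (\<forall>r\<ge>r0. \<forall>z. radius (f z) > r \<longrightarrow>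
      (\<forall>i j. i \<noteq> j \<longrightarrow> \<not> (\<bar>z $ i\<bar> > \<epsilon> * r \<and> \<bar>z $ j\<bar> > \<epsilon> * r)) \<longrightarrow>
      (\<sigma> = 1 \<longrightarrow> (\<forall>i. - (\<epsilon> * r) \<le> z $ i)) \<longrightarrow>
      (\<exists>i. dist (angle (f z)) (angle (g (\<sigma> *\<^sub>R axis i 1))) \<le> \<eta>))"
proof -
  define w where "w i = g (\<sigma> *\<^sub>R axis i 1)" for i
  \<comment> \<open>One constant for the factors in \<open>angle_near\<close> over all axes. The
    absolute value keeps every summand at least 1 whatever the sign of the radius, so that each is
    bounded by the sum.\<close>
  define B where "B = (\<Sum>i\<in>UNIV. 1 + norm (w i) / \<bar>radius (w i)\<bar>)"
  have B: "1 + norm (w i) / \<bar>radius (w i)\<bar> \<le> B" for i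
    unfolding B_def by (rule member_le_sum) auto
  have "1 + norm (w i) / \<bar>radius (w i)\<bar> \<ge> 1" for i by simp
  then have B1: "B \<ge> 1" using B order_trans by blast
  \<comment> \<open>The admissible relative error: below 1 as \<open>angle_near\<close> demands, and
    at most \<eta> after multiplication by \<open>B\<close>.\<close>
  define \<kappa> where "\<kappa> = min (1 / 2) (\<eta> / B)"
  have \<kappa>: "0 < \<kappa>" "\<kappa> < 1" "\<kappa> * B \<le> \<eta>"
    using \<eta> B1 by (auto simp: \<kappa>_def min_def field_simps)
  \<comment> \<open>Half of \<kappa> is reserved for the coordinates below the threshold. Adding 1
    avoids a division by zero for \<open>L = 0\<close>.\<close>
  define \<epsilon> where "\<epsilon> = min 1 (\<kappa> / (2 * (L * CARD('n) + 1)))"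
  have Ln: "L * CARD('n) \<ge> 0" using L by simp
  have \<epsilon>: "0 < \<epsilon>" "\<epsilon> \<le> 1" using \<kappa> Ln by (auto simp: \<epsilon>_def)
  define X where "X = L * CARD('n) + 1"
  have X: "X > 0" using Ln by (simp add: X_def)
  have "X * \<epsilon> \<le> X * (\<kappa> / (2 * X))"
    using X by (intro mult_left_mono) (auto simp: \<epsilon>_def X_def)
  also have "\<dots> = \<kappa> / 2" using X by simp
  finally have "(L * CARD('n) + 1) * \<epsilon> \<le> \<kappa> / 2" by (simp add: X_def)
  then have L\<epsilon>: "L * CARD('n) * \<epsilon> \<le> \<kappa> / 2" using \<epsilon> by (simp add: distrib_right)
  \<comment> \<open>Beyond \<open>r0\<close> the other half of \<kappa> absorbs \<open>D\<close>;
    the maximum with 1 keeps \<open>r\<close> positive.\<close>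
  define r0 where "r0 = max 1 (2 * D / \<kappa>)"
  have r0: "0 < r0" by (simp add: r0_def)
  have "\<exists>i. dist (angle (f z)) (angle (w i)) \<le> \<eta>"
    if r: "r \<ge> r0" and R: "radius (f z) > r"
      and one: "\<And>i j. i \<noteq> j \<Longrightarrow> \<not> (\<bar>z $ i\<bar> > \<epsilon> * r \<and> \<bar>z $ j\<bar> > \<epsilon> * r)"
      and pos: "\<sigma> = 1 \<Longrightarrow> \<forall>i. - (\<epsilon> * r) \<le> z $ i" for r z
  proof -
    have rp: "r > 0" using r r0 by simp
    have "2 * D / \<kappa> \<le> r" using r by (simp add: r0_def)
    then have "D \<le> \<kappa> / 2 * r" using \<kappa> by (simp add: field_simps)
    moreover have "L * (CARD('n) * (\<epsilon> * r)) \<le> \<kappa> / 2 * r"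
      using mult_right_mono[OF L\<epsilon>, of r] rp by (simp add: mult.assoc)
    ultimately have err: "D + L * (CARD('n) * (\<epsilon> * r)) \<le> \<kappa> * r" by simp
    obtain i where i: "\<And>j. j \<noteq> i \<Longrightarrow> \<bar>z $ j\<bar> \<le> \<epsilon> * r"
    proof (cases "\<exists>i. \<bar>z $ i\<bar> > \<epsilon> * r")
      case True
      then obtain i where "\<bar>z $ i\<bar> > \<epsilon> * r" by blast
      with one[of _ i] that[of i] show ?thesis by force
    next
      case False
      \<comment> \<open>No coordinate is large, so any index will do.\<close>
      with that[of undefined] show ?thesis by (auto simp: not_less)
    qed
    \<comment> \<open>Both signs are kept open: \<open>s = \<sigma>\<close> gives the conclusion,
      \<open>s = 1\<close> the contradiction in the case \<sigma> = -1.\<close>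
    have near: "radius (g (s *\<^sub>R axis i 1)) > 0 \<and> dist (angle (f z)) (angle (g (s *\<^sub>R axis i 1))) \<le>
        \<kappa> * (1 + norm (g (s *\<^sub>R axis i 1)) / radius (g (s *\<^sub>R axis i 1)))"
      if s: "s = 1 \<or> s = -1" "s * z $ i \<ge> - (\<epsilon> * r)" for s
    proof -
      have "l1 (f z - max (s * z $ i) 0 *\<^sub>R g (s *\<^sub>R axis i 1)) \<le> D + L * (CARD('n) * (\<epsilon> * r))"
        using rp \<epsilon> by (intro single_large_coordinate[OF L hom lip D s i]) auto
      then have "l1 (f z - max (s * z $ i) 0 *\<^sub>R g (s *\<^sub>R axis i 1)) \<le> \<kappa> * r"
        using err by linarith
      then show ?thesis using angle_near[OF _ R rp _ \<kappa>(2)] by auto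
    qed
    \<comment> \<open>For \<sigma> = -1 a violation means that \<open>z $ i\<close> is large and
      positive. Then \<open>near\<close> at the positive semi-axis forces \<open>g\<close> to have
      positive radius there, against the assumption on \<sigma>.\<close>
    have "\<sigma> * z $ i \<ge> - (\<epsilon> * r)"
    proof (rule ccontr)
      assume n: "\<not> \<sigma> * z $ i \<ge> - (\<epsilon> * r)"
      then have "\<sigma> \<noteq> 1" using pos by auto
      then have sg: "\<sigma> = -1" "radius (g (axis i 1)) \<le> 0" using \<sigma> by auto
      have "\<epsilon> * r > 0" using \<epsilon> rp by simp
      then have "1 * z $ i \<ge> - (\<epsilon> * r)" using n sg by simp
      from near[OF _ this] sg show False by simp
    qed
    with near[of \<sigma>] \<sigma> have w: "radius (w i) > 0"
      "dist (angle (f z)) (angle (w i)) \<le> \<kappa> * (1 + norm (w i) / radius (w i))"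
      unfolding w_def by auto
    have "\<kappa> * (1 + norm (w i) / radius (w i)) \<le> \<kappa> * B"
      using B[of i] w(1) \<kappa> by (intro mult_left_mono) auto
    with w(2) \<kappa>(3) show ?thesis by (intro exI[of _ i]) linarith
  qed
  then show ?thesis using \<epsilon> r0 unfolding w_def
    by (intro exI[of _ \<epsilon>] exI[of _ r0] conjI allI impI) simp_all
qed

section \<open>Regularly varying tails\<close>

text \<open>For positive \<open>t\<close> the event \<open>X > t * x\<close> is contained in
  \<open>X > t\<close>, so the conditional probability is a quotient of two values of the
  tail.\<close>

lemma (in prob_space) regularly_varying_tail:
  assumes X: "X \<in> borel_measurable M" and rv: "regularly_varying M X \<alpha>"
  defines "H \<equiv> \<lambda>t. \<P>(\<omega> in M. X \<omega> > t)"
  shows "\<alpha> > 0" and "antimono H" and "\<And>t. H t > 0"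
    and "\<And>x. x \<ge> 1 \<Longrightarrow> ((\<lambda>t. H (x * t) / H t) \<longlongrightarrow> x powr (- \<alpha>)) at_top"
proof -
  show "\<alpha> > 0" using rv unfolding regularly_varying_def by simp
  have lim: "((\<lambda>t. \<P>(\<omega> in M. X \<omega> > t * x \<bar> X \<omega> > t)) \<longlongrightarrow> x powr (- \<alpha>)) at_top" if "x \<ge> 1" for x
    using rv that unfolding regularly_varying_def by blast
  show mono: "antimono H"
  proof (rule antimonoI)
    fix s t :: real assume "s \<le> t"
    then show "H t \<le> H s" unfolding H_def using X by (intro finite_measure_mono) auto
  qed
  have *: "\<forall>\<^sub>F t in at_top. \<P>(\<omega> in M. X \<omega> > t * x \<bar> X \<omega> > t) = H (x * t) / H t" if "x \<ge> 1" for x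
    using eventually_gt_at_top[of 0]
  proof eventually_elim
    case (elim t)
    have "t \<le> x * t" using elim that by simp
    then have "(x * t < y \<and> t < y) \<longleftrightarrow> x * t < y" for y :: real by auto
    then show ?case unfolding cond_prob_def H_def by (simp add: mult.commute)
  qed
  show lim': "((\<lambda>t. H (x * t) / H t) \<longlongrightarrow> x powr (- \<alpha>)) at_top" if "x \<ge> 1" for x
    using Lim_transform_eventually[OF lim[OF that] *[OF that]] .
  show "H t > 0" for t
  proof (rule ccontr)
    assume "\<not> H t > 0"
    then have "H s = 0" if "s \<ge> t" for s
      using antimonoD[OF mono that] measure_nonneg[of M "{\<omega> \<in> space M. X \<omega> > s}"]
      unfolding H_def by linarith
    \<comment> \<open>Division by zero gives the quotient 0, whereas the limit for
      \<open>x = 1\<close> is 1.\<close>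
    then have "\<forall>\<^sub>F s in at_top. H (1 * s) / H s = 0"
      by (intro eventually_mono[OF eventually_ge_at_top[of t]]) simp
    then have "((\<lambda>s. H (1 * s) / H s) \<longlongrightarrow> 0) at_top" by (rule tendsto_eventually)
    with lim'[of 1] show False using tendsto_unique[OF trivial_limit_at_top_linorder] by fastforce
  qed
qed

text \<open>Substitute \<open>a * t\<close> for \<open>t\<close> in the limit at
  \<open>x = b / a\<close>.\<close>

lemma tail_ratio_tendsto:
  fixes H :: "real \<Rightarrow> real"
  assumes lim: "\<And>x. x \<ge> 1 \<Longrightarrow> ((\<lambda>t. H (x * t) / H t) \<longlongrightarrow> x powr (- \<alpha>)) at_top"
    and ab: "0 < a" "a \<le> b"
  shows "((\<lambda>t. H (b * t) / H (a * t)) \<longlongrightarrow> (b / a) powr (- \<alpha>)) at_top"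
proof -
  have "filterlim (\<lambda>t. a * t) at_top at_top"
    using ab by (intro filterlim_tendsto_pos_mult_at_top[OF tendsto_const] filterlim_ident)
  from filterlim_compose[OF lim[of "b / a"] this] show ?thesis using ab by simp
qed

text \<open>The square of \<open>H\<close> behaves like a tail of index \<open>2 * \<alpha>\<close>,
  so it decays faster than \<open>K\<close>, although \<open>H\<close> and \<open>K\<close>
  themselves need not be comparable.\<close>

lemma tail_square_negligible:
  fixes H K :: "real \<Rightarrow> real"
  assumes H: "\<And>t. 0 < H t" "\<And>t. H t \<le> 1" and K: "\<And>t. 0 < K t" "antimono K" and \<alpha>: "\<alpha> > 0"
    and limH: "((\<lambda>t. H (2 * t) / H t) \<longlongrightarrow> 2 powr (- \<alpha>)) at_top"
    and limK: "((\<lambda>t. K (2 * t) / K t) \<longlongrightarrow> 2 powr (- \<alpha>)) at_top"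
  shows "((\<lambda>t. (H t)\<^sup>2 / K t) \<longlongrightarrow> 0) at_top"
proof -
  \<comment> \<open>Doubling \<open>t\<close> multiplies the ratio by about \<open>2 powr (- \<alpha>)\<close>, so it decays geometrically
    along dyadic blocks.\<close>
  define q where "q t = (H t)\<^sup>2 / K t" for t
  \<comment> \<open>The midpoint between the limiting ratio and 1: large enough to dominate the
    ratio eventually, small enough for geometric decay.\<close>
  define \<theta> where "\<theta> = ((2 powr (- \<alpha>)) + 1) / 2"
  have p: "0 < 2 powr (- \<alpha>)" "2 powr (- \<alpha>) < 1"
    using \<alpha> by (simp_all add: powr_less_one)
  then have \<theta>: "0 < \<theta>" "\<theta> < 1" "2 powr (- \<alpha>) < \<theta>"
    unfolding \<theta>_def by (simp_all add: add_pos_pos)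
  have "((\<lambda>t. (H (2 * t) / H t)\<^sup>2 / (K (2 * t) / K t)) \<longlongrightarrow> (2 powr (- \<alpha>))\<^sup>2 / (2 powr (- \<alpha>))) at_top"
    using p by (intro tendsto_intros limH limK) auto
  moreover have "(2 powr (- \<alpha>))\<^sup>2 / (2 powr (- \<alpha>)) < \<theta>"
    using \<theta> p by (simp add: power2_eq_square)
  ultimately have "\<forall>\<^sub>F t in at_top. (H (2 * t) / H t)\<^sup>2 / (K (2 * t) / K t) < \<theta>"
    by (rule order_tendstoD)
  then obtain T0 where T0: "\<And>t. t \<ge> T0 \<Longrightarrow> (H (2 * t) / H t)\<^sup>2 / (K (2 * t) / K t) < \<theta>"
    unfolding eventually_at_top_linorder by blast
  define T where "T = max T0 1"
  have T: "T > 0" unfolding T_def by simp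
  have q0: "q t \<ge> 0" for t using K(1)[of t] by (simp add: q_def)
  have step: "q (2 * t) \<le> \<theta> * q t" if "t \<ge> T" for t
  proof -
    have "q (2 * t) = ((H (2 * t) / H t)\<^sup>2 / (K (2 * t) / K t)) * q t"
      using H(1)[of t] K(1)[of t] by (simp add: q_def power_divide)
    also have "\<dots> \<le> \<theta> * q t"
      using T0[of t] that q0 by (intro mult_right_mono) (auto simp: T_def)
    finally show ?thesis .
  qed
  \<comment> \<open>On the first block \<open>q\<close> is at most \<open>1 / K (2 * T)\<close>,
    since \<open>H\<close> is at most 1 and \<open>K\<close> decreases; each further block gains a
    factor \<theta> by halving \<open>t\<close>.\<close>
  have bound: "q t \<le> \<theta> ^ k / K (2 * T)" if "2 ^ k * T \<le> t" "t \<le> 2 ^ Suc k * T" for k t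
    using that
  proof (induction k arbitrary: t)
    case 0
    have "K (2 * T) \<le> K t" using 0 K(2) by (auto dest: antimonoD)
    moreover have "(H t)\<^sup>2 \<le> 1" using H[of t] by (simp add: abs_square_le_1 power_le_one less_imp_le)
    ultimately show ?case using K(1) by (auto simp: q_def intro!: frac_le)
  next
    case (Suc k)
    have "T \<le> 2 ^ k * T" using T by simp
    then have "T \<le> t / 2" using Suc.prems by simp
    then have "q t \<le> \<theta> * q (t / 2)" using step[of "t / 2"] by simp
    also have "\<dots> \<le> \<theta> * (\<theta> ^ k / K (2 * T))"
      using Suc.prems \<theta> by (intro mult_left_mono Suc.IH) auto
    finally show ?case by simp
  qed
  have "\<forall>\<^sub>F t in at_top. q t < e" if "e > 0" for e
  proof -
    have "(\<lambda>k. \<theta> ^ k / K (2 * T)) \<longlonglongrightarrow> 0 / K (2 * T)"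
      using \<theta> K(1)[of "2 * T"] by (intro tendsto_divide LIMSEQ_power_zero tendsto_const) auto
    then have "\<forall>\<^sub>F k in sequentially. \<theta> ^ k / K (2 * T) < e"
      using that by (intro order_tendstoD(2)) auto
    then obtain N where N: "\<And>k. k \<ge> N \<Longrightarrow> \<theta> ^ k / K (2 * T) < e"
      unfolding eventually_sequentially by blast
    have "q t < e" if t: "t \<ge> 2 ^ N * T" for t
    proof -
      have tT: "t / T \<ge> 2 ^ N" using t T by (simp add: field_simps)
      then have "t / T \<ge> 1" using one_le_power[of "2::real" N] by linarith
      \<comment> \<open>The dyadic block of \<open>t\<close>. Minimality gives
        \<open>2 ^ k \<le> t / T\<close>, except for \<open>k = 0\<close>, where
        \<open>t / T \<ge> 1\<close> is used.\<close>
      define k where "k = (LEAST k. t / T < 2 ^ Suc k)"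
      obtain k0 where "t / T < 2 ^ k0" using real_arch_pow[of 2 "t / T"] by auto
      then have "t / T < 2 ^ Suc k0" using \<open>t / T \<ge> 1\<close> by simp
      then have "\<exists>k. t / T < 2 ^ Suc k" ..
      then have k2: "t / T < 2 ^ Suc k" unfolding k_def by (rule LeastI_ex)
      have k1: "2 ^ k \<le> t / T"
      proof (cases k)
        case (Suc j)
        then show ?thesis using not_less_Least[of j "\<lambda>k. t / T < 2 ^ Suc k"] unfolding k_def by simp
      qed (use \<open>t / T \<ge> 1\<close> in simp)
      have "(2::real) ^ N < 2 ^ Suc k" using tT k2 by linarith
      then have "N \<le> k" by (simp add: power_strict_increasing_iff del: power_Suc)
      moreover have "q t \<le> \<theta> ^ k / K (2 * T)"
        using k1 k2 T by (intro bound) (auto simp: field_simps)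
      ultimately show ?thesis using N[of k] by linarith
    qed
    then show ?thesis unfolding eventually_at_top_linorder by blast
  qed
  then have "(q \<longlongrightarrow> 0) at_top"
    using q0 by (intro order_tendstoI) (auto intro: always_eventually order.strict_trans2)
  then show ?thesis unfolding q_def .
qed

lemma borel_measurable_component:
  fixes Z :: "'a \<Rightarrow> real ^ 'n"
  assumes "Z \<in> borel_measurable M"
  shows "(\<lambda>\<omega>. Z \<omega> $ j) \<in> borel_measurable M"
  by (rule measurable_compose[OF assms borel_measurable_continuous_onI])
    (intro continuous_intros)

text \<open>Both quotients are factored into quotients of tails with known limits. The first relies
  on the common index through \<open>tail_square_negligible\<close>. The second compares the left
  tail with \<open>K\<close> and takes a domination of \<open>H (C * r)\<close> as a premise of its
  own, which is available when a positive semi-axis contributes to the radius.\<close>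

lemma tails_negligible:
  fixes H K N :: "real \<Rightarrow> real"
  assumes H: "\<And>t. 0 < H t" "\<And>t. H t \<le> 1" and K: "\<And>t. 0 < K t" "antimono K" and \<alpha>: "\<alpha> > 0"
    and limH: "\<And>x. x \<ge> 1 \<Longrightarrow> ((\<lambda>t. H (x * t) / H t) \<longlongrightarrow> x powr (- \<alpha>)) at_top"
    and limK: "\<And>x. x \<ge> 1 \<Longrightarrow> ((\<lambda>t. K (x * t) / K t) \<longlongrightarrow> x powr (- \<alpha>)) at_top"
    and N: "((\<lambda>t. N t / H t) \<longlongrightarrow> 0) at_top" and \<epsilon>: "0 < \<epsilon>" "\<epsilon> \<le> 1"
  shows "((\<lambda>r. (H (\<epsilon> * r) + N (\<epsilon> * r))\<^sup>2 / K r) \<longlongrightarrow> 0) at_top" (is ?A)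
    and "\<lbrakk>\<And>t. 0 \<le> N t; C \<ge> 1; c > 0; \<forall>\<^sub>F r in at_top. c * H (C * r) \<le> K r\<rbrakk> \<Longrightarrow>
      ((\<lambda>r. N (\<epsilon> * r) / K r) \<longlongrightarrow> 0) at_top"
proof -
  have scale: "filterlim (\<lambda>t. \<epsilon> * t) at_top at_top"
    using \<epsilon> by (intro filterlim_tendsto_pos_mult_at_top[OF tendsto_const] filterlim_ident)
  have NH: "((\<lambda>r. N (\<epsilon> * r) / H (\<epsilon> * r)) \<longlongrightarrow> 0) at_top"
    by (rule filterlim_compose[OF N scale])
  have "((\<lambda>t. (H t)\<^sup>2 / K t) \<longlongrightarrow> 0) at_top"
    by (rule tail_square_negligible[OF H K \<alpha> limH limK]) auto
  then have sq: "((\<lambda>r. (H (\<epsilon> * r))\<^sup>2 / K (\<epsilon> * r)) \<longlongrightarrow> 0) at_top"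
    by (rule filterlim_compose[OF _ scale])
  have KK: "((\<lambda>r. K (1 * r) / K (\<epsilon> * r)) \<longlongrightarrow> (1 / \<epsilon>) powr (- \<alpha>)) at_top"
    by (rule tail_ratio_tendsto[OF limK \<epsilon>])
  \<comment> \<open>Replacing \<open>K (\<epsilon> * r)\<close> by \<open>K r\<close> costs a factor
    with a finite limit, and adding \<open>N\<close> to \<open>H\<close> changes the numerator by a
    factor tending to 1.\<close>
  have "((\<lambda>r. (H (\<epsilon> * r))\<^sup>2 / K (\<epsilon> * r) / (K (1 * r) / K (\<epsilon> * r)) *
      (1 + N (\<epsilon> * r) / H (\<epsilon> * r))\<^sup>2) \<longlongrightarrow> 0 / (1 / \<epsilon>) powr (- \<alpha>) * (1 + 0)\<^sup>2) at_top"
    using \<epsilon> by (intro tendsto_intros sq KK NH) auto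
  moreover have "\<And>r. (H (\<epsilon> * r))\<^sup>2 / K (\<epsilon> * r) / (K (1 * r) / K (\<epsilon> * r)) *
      (1 + N (\<epsilon> * r) / H (\<epsilon> * r))\<^sup>2 = (H (\<epsilon> * r) + N (\<epsilon> * r))\<^sup>2 / K r" (is "\<And>r. ?eq r")
  proof -
    fix r
    have "1 + N (\<epsilon> * r) / H (\<epsilon> * r) = (H (\<epsilon> * r) + N (\<epsilon> * r)) / H (\<epsilon> * r)"
      using H(1)[of "\<epsilon> * r"] by (simp add: field_simps)
    then show "?eq r"
      using H(1)[of "\<epsilon> * r"] K(1)[of "\<epsilon> * r"] K(1)[of r] by (simp add: power_divide)
  qed
  ultimately show ?A by (simp only:) simp
  assume N0: "\<And>t. 0 \<le> N t" and C: "C \<ge> 1" "c > 0" and lb: "\<forall>\<^sub>F r in at_top. c * H (C * r) \<le> K r"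
  have "((\<lambda>r. N (\<epsilon> * r) / H (\<epsilon> * r) / (H (C * r) / H (\<epsilon> * r)) / c) \<longlongrightarrow>
      0 / (C / \<epsilon>) powr (- \<alpha>) / c) at_top"
    using \<epsilon> C by (intro tendsto_intros NH tail_ratio_tendsto[OF limH]) auto
  moreover have "N (\<epsilon> * r) / H (\<epsilon> * r) / (H (C * r) / H (\<epsilon> * r)) / c = N (\<epsilon> * r) / (c * H (C * r))" for r
    using H(1)[of "\<epsilon> * r"] by (simp add: mult.commute)
  ultimately have u: "((\<lambda>r. N (\<epsilon> * r) / (c * H (C * r))) \<longlongrightarrow> 0) at_top" by (simp only:) simp
  show "((\<lambda>r. N (\<epsilon> * r) / K r) \<longlongrightarrow> 0) at_top"
  proof (rule tendsto_sandwich[OF _ _ tendsto_const u])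
    show "\<forall>\<^sub>F r in at_top. 0 \<le> N (\<epsilon> * r) / K r"
      using N0 K(1) by (intro always_eventually allI divide_nonneg_pos)
    show "\<forall>\<^sub>F r in at_top. N (\<epsilon> * r) / K r \<le> N (\<epsilon> * r) / (c * H (C * r))"
      using lb by eventually_elim (use N0 C H(1) in \<open>auto intro!: divide_left_mono mult_pos_pos K(1)\<close>)
  qed
qed

section \<open>Probability bounds for independent coordinates\<close>

lemma (in prob_space) exists_bound_pos_prob:
  fixes Y :: "'a \<Rightarrow> real"
  assumes Y[measurable]: "Y \<in> borel_measurable M"
  shows "\<exists>k\<ge>0. prob (Y -` {- k..k} \<inter> space M) > 0"
proof (rule ccontr)
  assume neg: "\<not> ?thesis"
  \<comment> \<open>Otherwise the modulus of \<open>Y\<close> would exceed every natural number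
    almost surely.\<close>
  have "AE \<omega> in M. \<forall>k :: nat. \<not> \<bar>Y \<omega>\<bar> \<le> real k"
  proof (rule AE_all_countable[THEN iffD2], rule allI)
    fix k :: nat
    have "prob (Y -` {- real k..real k} \<inter> space M) = 0"
      using neg by (metis measure_nonneg of_nat_0_le_iff order_le_less)
    then have "AE \<omega> in M. \<omega> \<notin> Y -` {- real k..real k} \<inter> space M"
      by (subst (asm) prob_eq_0) measurable
    then show "AE \<omega> in M. \<not> \<bar>Y \<omega>\<bar> \<le> real k"
      by (rule AE_mp) (auto intro!: AE_I2)
  qed
  then have "AE \<omega> in M. False"
    by eventually_elim (meson real_arch_simple)
  then show False by simp
qed

text \<open>With a positive probability not depending on \<open>r\<close>, the other coordinates
  stay in fixed bounded windows. Then \<open>f (Z \<omega>)\<close> differs from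
  \<open>Z \<omega> $ i\<close> times \<open>g (axis i 1)\<close> by a bounded amount, so a large
  \<open>Z \<omega> $ i\<close> alone makes the radius large. Independence multiplies the two
  probabilities.\<close>

lemma (in prob_space) tail_lower_bound:
  fixes Z :: "'a \<Rightarrow> real ^ 'n" and f g :: "real ^ 'n \<Rightarrow> real ^ 'm"
  assumes Z[measurable]: "Z \<in> borel_measurable M"
    and indep: "indep_vars (\<lambda>_. borel) (\<lambda>i \<omega>. Z \<omega> $ i) UNIV"
    and fZ[measurable]: "(\<lambda>\<omega>. radius (f (Z \<omega>))) \<in> borel_measurable M"
    and L: "0 \<le> L" and hom: "\<And>c x. c \<ge> 0 \<Longrightarrow> g (c *\<^sub>R x) = c *\<^sub>R g x"
    and lip: "\<And>x y. l1 (g x - g y) \<le> L * l1 (x - y)" and D: "\<And>x. l1 (f x - g x) \<le> D"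
    and \<rho>: "radius (g (axis i 1)) > 0"
  shows "\<exists>C c. C \<ge> 1 \<and> c > 0 \<and>
    (\<forall>\<^sub>F r in at_top. c * \<P>(\<omega> in M. Z \<omega> $ i > C * r) \<le> \<P>(\<omega> in M. radius (f (Z \<omega>)) > r))"
proof -
  have Zi[measurable]: "(\<lambda>\<omega>. Z \<omega> $ j) \<in> borel_measurable M" for j
    by (rule borel_measurable_component[OF Z])
  have "\<exists>k\<ge>0. prob ((\<lambda>\<omega>. Z \<omega> $ j) -` {- k..k} \<inter> space M) > 0" for j
    by (rule exists_bound_pos_prob) simp
  then obtain k where k: "\<And>j. k j \<ge> 0"
    "\<And>j. prob ((\<lambda>\<omega>. Z \<omega> $ j) -` {- k j..k j} \<inter> space M) > 0" by metis
  define \<delta> where "\<delta> = (\<Sum>j\<in>UNIV. k j)"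
  have k\<delta>: "k j \<le> \<delta>" for j unfolding \<delta>_def using k by (intro member_le_sum) auto
  then have \<delta>: "0 \<le> \<delta>" using k order_trans by blast
  define \<rho> where "\<rho> = radius (g (axis i 1))"
  define E where "E = D + L * (CARD('n) * \<delta>)"
  \<comment> \<open>\<open>C * \<rho>\<close> is at least 2, so that
    \<open>Z \<omega> $ i > C * r\<close> yields a main term above \<open>2 * r\<close>: one
    \<open>r\<close> absorbs the error \<open>E\<close>, the other remains.\<close>
  define C where "C = max 1 (2 / \<rho>)"
  define c where "c = (\<Prod>j\<in>UNIV - {i}. prob ((\<lambda>\<omega>. Z \<omega> $ j) -` {- k j..k j} \<inter> space M))"
  have \<rho>0: "\<rho> > 0" using assms by (simp add: \<rho>_def)
  have C: "C \<ge> 1" "C * \<rho> \<ge> 2" using \<rho>0 by (auto simp: C_def max_def field_simps)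
  have c: "c > 0" unfolding c_def using k by (intro prod_pos) auto
  have "c * \<P>(\<omega> in M. Z \<omega> $ i > C * r) \<le> \<P>(\<omega> in M. radius (f (Z \<omega>)) > r)"
    if r: "r \<ge> max 0 E" for r
  proof -
    define A where "A j = (if j = i then {C * r<..} else {- k j..k j})" for j
    have "c * \<P>(\<omega> in M. Z \<omega> $ i > C * r) = (\<Prod>j\<in>UNIV. prob ((\<lambda>\<omega>. Z \<omega> $ j) -` A j \<inter> space M))"
    proof -
      have e: "(\<lambda>\<omega>. Z \<omega> $ i) -` A i \<inter> space M = {\<omega> \<in> space M. Z \<omega> $ i > C * r}"
        by (auto simp: A_def)
      show ?thesis
        unfolding prod.remove[OF finite_class.finite_UNIV UNIV_I, of _ i] e c_def
        by (subst mult.commute, intro arg_cong2[of _ _ _ _ "(*)"] prod.cong) (auto simp: A_def)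
    qed
    also have "\<dots> = prob (\<Inter>j\<in>UNIV. (\<lambda>\<omega>. Z \<omega> $ j) -` A j \<inter> space M)"
      by (rule indep_varsD[OF indep, symmetric]) (auto simp: A_def)
    also have "\<dots> \<le> \<P>(\<omega> in M. radius (f (Z \<omega>)) > r)"
    proof (rule finite_measure_mono)
      show "(\<Inter>j\<in>UNIV. (\<lambda>\<omega>. Z \<omega> $ j) -` A j \<inter> space M) \<subseteq> {\<omega> \<in> space M. radius (f (Z \<omega>)) > r}"
      proof
        fix \<omega> assume "\<omega> \<in> (\<Inter>j\<in>UNIV. (\<lambda>\<omega>. Z \<omega> $ j) -` A j \<inter> space M)"
        then have \<omega>: "\<omega> \<in> space M" "\<And>j. Z \<omega> $ j \<in> A j" by auto
        have zi: "Z \<omega> $ i > C * r" using \<omega>(2)[of i] by (simp add: A_def)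
        have Cr: "C * r \<ge> 0" using C r by simp
        have zj: "\<bar>Z \<omega> $ j\<bar> \<le> \<delta>" if "j \<noteq> i" for j
          using \<omega>(2)[of j] k\<delta>[of j] that by (simp add: A_def abs_le_iff)
        have "l1 (f (Z \<omega>) - max (1 * Z \<omega> $ i) 0 *\<^sub>R g (1 *\<^sub>R axis i 1)) \<le> E"
          unfolding E_def using zi Cr \<delta> zj
          by (intro single_large_coordinate[OF L hom lip D]) auto
        then have "l1 (f (Z \<omega>) - Z \<omega> $ i *\<^sub>R g (axis i 1)) \<le> E" using zi Cr by simp
        then have "\<bar>radius (f (Z \<omega>) - Z \<omega> $ i *\<^sub>R g (axis i 1))\<bar> \<le> E"
          using abs_radius_le_l1 order_trans by blast
        moreover have "radius (f (Z \<omega>) - Z \<omega> $ i *\<^sub>R g (axis i 1)) = radius (f (Z \<omega>)) - Z \<omega> $ i * \<rho>"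
          unfolding \<rho>_def radius_def by (simp add: sum_subtractf sum_distrib_left)
        moreover have "Z \<omega> $ i * \<rho> > C * r * \<rho>" using zi \<rho>0 by simp
        moreover have "C * r * \<rho> \<ge> 2 * r"
          using mult_right_mono[OF C(2), of r] r by (simp add: mult_ac)
        ultimately show "\<omega> \<in> {\<omega> \<in> space M. radius (f (Z \<omega>)) > r}" using \<omega>(1) r by auto
      qed
    qed measurable
    finally show ?thesis .
  qed
  then show ?thesis
    using C(1) c by (intro exI[of _ C] exI[of _ c] conjI eventually_at_top_linorderI[of "max 0 E"])
qed

text \<open>A union bound over all ordered pairs, where independence bounds each pair by a product.
  Diagonal pairs are empty events but are counted, which produces the full square of the
  dimension.\<close>

lemma (in prob_space) bad_event_bound:
  fixes Z :: "'a \<Rightarrow> real ^ 'n" and t h n :: real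
  assumes Z[measurable]: "Z \<in> borel_measurable M"
    and indep: "indep_vars (\<lambda>_. borel) (\<lambda>i \<omega>. Z \<omega> $ i) UNIV"
    and H: "\<And>i. \<P>(\<omega> in M. Z \<omega> $ i > t) = h" and N: "\<And>i. \<P>(\<omega> in M. Z \<omega> $ i < - t) = n"
  shows "\<P>(\<omega> in M. \<exists>i j. i \<noteq> j \<and> \<bar>Z \<omega> $ i\<bar> > t \<and> \<bar>Z \<omega> $ j\<bar> > t) \<le> (CARD('n))\<^sup>2 * (h + n)\<^sup>2"
    and "\<P>(\<omega> in M. \<exists>i. Z \<omega> $ i < - t) \<le> CARD('n) * n"
proof -
  have Zi[measurable]: "(\<lambda>\<omega>. Z \<omega> $ j) \<in> borel_measurable M" for j
    by (rule borel_measurable_component[OF Z])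
  have n0: "0 \<le> n" "0 \<le> h" unfolding N[of undefined, symmetric] H[of undefined, symmetric] by simp_all
  have one: "\<P>(\<omega> in M. \<bar>Z \<omega> $ i\<bar> > t) \<le> h + n" for i
  proof -
    have "\<P>(\<omega> in M. \<bar>Z \<omega> $ i\<bar> > t) \<le> prob ({\<omega> \<in> space M. Z \<omega> $ i > t} \<union> {\<omega> \<in> space M. Z \<omega> $ i < - t})"
      by (intro finite_measure_mono) auto
    also have "\<dots> \<le> h + n" unfolding H[of i, symmetric] N[of i, symmetric]
      by (rule measure_Un_le) auto
    finally show ?thesis .
  qed
  have two: "\<P>(\<omega> in M. i \<noteq> j \<and> \<bar>Z \<omega> $ i\<bar> > t \<and> \<bar>Z \<omega> $ j\<bar> > t) \<le> (h + n)\<^sup>2" for i j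
  proof (cases "i = j")
    case False
    have v: "(\<lambda>\<omega>. Z \<omega> $ l) -` {x. \<bar>x\<bar> > t} \<inter> space M = {\<omega> \<in> space M. \<bar>Z \<omega> $ l\<bar> > t}" for l
      by auto
    have "prob (\<Inter>l\<in>{i, j}. (\<lambda>\<omega>. Z \<omega> $ l) -` {x. \<bar>x\<bar> > t} \<inter> space M) =
        (\<Prod>l\<in>{i, j}. prob ((\<lambda>\<omega>. Z \<omega> $ l) -` {x. \<bar>x\<bar> > t} \<inter> space M))"
      by (rule indep_varsD[OF indep]) auto
    also have "\<dots> = \<P>(\<omega> in M. \<bar>Z \<omega> $ i\<bar> > t) * \<P>(\<omega> in M. \<bar>Z \<omega> $ j\<bar> > t)"
      using False unfolding v by simp
    also have "\<dots> \<le> (h + n)\<^sup>2"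
      unfolding power2_eq_square using n0 by (intro mult_mono one) auto
    also have "(\<Inter>l\<in>{i, j}. (\<lambda>\<omega>. Z \<omega> $ l) -` {x. \<bar>x\<bar> > t} \<inter> space M) =
        {\<omega> \<in> space M. i \<noteq> j \<and> \<bar>Z \<omega> $ i\<bar> > t \<and> \<bar>Z \<omega> $ j\<bar> > t}"
      using False by auto
    finally show ?thesis .
  qed simp
  have "{\<omega> \<in> space M. \<exists>i j. i \<noteq> j \<and> \<bar>Z \<omega> $ i\<bar> > t \<and> \<bar>Z \<omega> $ j\<bar> > t} =
      (\<Union>(i, j)\<in>UNIV. {\<omega> \<in> space M. i \<noteq> j \<and> \<bar>Z \<omega> $ i\<bar> > t \<and> \<bar>Z \<omega> $ j\<bar> > t})" by auto
  then have "\<P>(\<omega> in M. \<exists>i j. i \<noteq> j \<and> \<bar>Z \<omega> $ i\<bar> > t \<and> \<bar>Z \<omega> $ j\<bar> > t) \<le>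
      (\<Sum>(i, j)\<in>UNIV. \<P>(\<omega> in M. i \<noteq> j \<and> \<bar>Z \<omega> $ i\<bar> > t \<and> \<bar>Z \<omega> $ j\<bar> > t))"
    by (simp only: case_prod_unfold) (intro finite_measure_subadditive_finite, auto)
  also have "\<dots> \<le> (\<Sum>(i, j)\<in>(UNIV :: ('n \<times> 'n) set). (h + n)\<^sup>2)"
    unfolding case_prod_unfold by (intro sum_mono two)
  also have "\<dots> = (CARD('n))\<^sup>2 * (h + n)\<^sup>2"
    by (simp add: case_prod_unfold card_cartesian_product power2_eq_square flip: UNIV_Times_UNIV)
  finally show "\<P>(\<omega> in M. \<exists>i j. i \<noteq> j \<and> \<bar>Z \<omega> $ i\<bar> > t \<and> \<bar>Z \<omega> $ j\<bar> > t) \<le> (CARD('n))\<^sup>2 * (h + n)\<^sup>2" .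
  have "{\<omega> \<in> space M. \<exists>i. Z \<omega> $ i < - t} = (\<Union>i\<in>UNIV. {\<omega> \<in> space M. Z \<omega> $ i < - t})" by auto
  then have "\<P>(\<omega> in M. \<exists>i. Z \<omega> $ i < - t) \<le> (\<Sum>i\<in>UNIV. \<P>(\<omega> in M. Z \<omega> $ i < - t))"
    by (simp only:) (intro finite_measure_subadditive_finite, auto)
  also have "\<dots> = CARD('n) * n" by (simp add: N)
  finally show "\<P>(\<omega> in M. \<exists>i. Z \<omega> $ i < - t) \<le> CARD('n) * n" .
qed

section \<open>The angular measure\<close>

lemma (in prob_space) integral_le_bad_event:
  fixes Y :: "'a \<Rightarrow> real"
  assumes Y[measurable]: "Y \<in> borel_measurable M" and B[measurable]: "B \<in> events"
    and ae: "AE \<omega> in M. 0 \<le> Y \<omega> \<and> Y \<omega> \<le> \<eta> + indicator B \<omega>"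
  shows "expectation Y \<le> \<eta> + prob B"
proof -
  have "integrable M Y"
  proof (rule integrable_const_bound)
    show "AE \<omega> in M. norm (Y \<omega>) \<le> \<bar>\<eta>\<bar> + 1"
      using ae by eventually_elim (auto split: split_indicator_asm)
  qed simp
  moreover have "integrable M (\<lambda>\<omega>. \<eta> + indicator B \<omega> :: real)"
    by (intro Bochner_Integration.integrable_add integrable_real_indicator) (auto simp: emeasure_eq_measure)
  ultimately have "expectation Y \<le> expectation (\<lambda>\<omega>. \<eta> + indicator B \<omega>)"
    using ae by (intro integral_mono_AE) auto
  also have "\<dots> = \<eta> + prob B"
    using sets.sets_into_space[OF B]
    by (subst Bochner_Integration.integral_add)
      (auto simp: prob_space emeasure_eq_measure Int_absorb2 intro!: integrable_real_indicator)
  finally show ?thesis .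
qed

text \<open>Points of \<open>V\<close> without mass are discarded because the weights must be
  positive, so \<open>n'\<close> may fall below the size of \<open>V\<close>. A point of positive
  mass outside the simplex would push the total mass above 1.\<close>

lemma finite_support_decomposition:
  fixes S :: "(real ^ 'm) measure"
  assumes S: "prob_space S" "sets S = sets borel" and \<Delta>: "measure S std_simplex = 1"
    and V: "finite V" "AE x in S. x \<in> V"
  shows "\<exists>n' (v :: nat \<Rightarrow> real ^ 'm) (p :: nat \<Rightarrow> real).
    n' \<le> card V \<and>
    (\<forall>i\<in>{1..n'}. v i \<in> std_simplex) \<and>
    (\<forall>i\<in>{1..n'}. p i > 0) \<and>
    (\<Sum>i=1..n'. p i) = 1 \<and>
    (\<forall>A\<in>sets borel. measure S A = (\<Sum>i=1..n'. p i * measure (return borel (v i)) A))"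
proof -
  interpret prob_space S by fact
  define W where "W = {x \<in> V. measure S {x} > 0}"
  have W: "finite W" "W \<subseteq> V" unfolding W_def using V by auto
  have sing[measurable]: "A \<in> sets S" if "A \<subseteq> V" for A
    using V(1) that S(2) finite_subset by (metis borel_closed finite_imp_closed)
  have AEW: "AE x in S. x \<in> W"
  proof -
    have "AE x in S. \<forall>y\<in>V - W. x \<noteq> y"
    proof (rule AE_finite_allI)
      fix y assume "y \<in> V - W"
      then have "prob {y} = 0" "{y} \<in> sets S" by (auto simp: W_def zero_less_measure_iff intro: sing)
      then show "AE x in S. x \<noteq> y" by (intro AE_I[of _ _ "{y}"]) (auto simp: emeasure_eq_measure)
    qed (use V in auto)
    with V(2) show ?thesis by eventually_elim auto
  qed
  have meas: "measure S A = (\<Sum>x\<in>W. measure S {x} * indicator A x)" if "A \<in> sets borel" for A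
  proof -
    have "measure S A = measure S (A \<inter> W)"
      using AEW that S(2) sing[OF W(2)] by (intro measure_eq_AE) auto
    also have "\<dots> = (\<Sum>x\<in>A \<inter> W. measure S {x})"
      using W sing by (intro finite_measure_eq_sum_singleton) auto
    also have "\<dots> = (\<Sum>x\<in>W. measure S {x} * indicator A x)"
      using W by (intro sum.mono_neutral_cong_left) (auto split: split_indicator_asm)
    finally show ?thesis .
  qed
  have Wsimp: "x \<in> std_simplex" if "x \<in> W" for x
  proof (rule ccontr)
    assume x: "x \<notin> std_simplex"
    \<comment> \<open>\<open>measure\<close> vanishes on non-measurable sets, so mass 1 entails
      measurability of the simplex.\<close>
    have s: "std_simplex \<in> events" using \<Delta> measure_notin_sets by fastforce
    have sx: "{x} \<in> events" using that W by (intro sing) auto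
    have "prob (std_simplex \<union> {x}) = prob std_simplex + prob {x}"
      using x s sx by (intro finite_measure_Union) auto
    moreover have "prob {x} > 0" using that by (simp add: W_def)
    ultimately show False using \<Delta> prob_le_1[of "std_simplex \<union> {x}"] by linarith
  qed
  obtain v where v: "bij_betw v {1..card W} W"
    using ex_bij_betw_nat_finite_1[OF W(1)] by blast
  have vW: "v i \<in> W" if "i \<in> {1..card W}" for i using v that by (auto simp: bij_betw_def)
  have sum: "measure S A = (\<Sum>i=1..card W. measure S {v i} * indicator A (v i))" if "A \<in> sets borel" for A
    unfolding meas[OF that] by (rule sum.reindex_bij_betw[OF v, symmetric])
  show ?thesis
  proof (rule exI[of _ "card W"], rule exI[of _ v], rule exI[of _ "\<lambda>i. measure S {v i}"],
      intro conjI ballI)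
    show "card W \<le> card V" using W V by (intro card_mono)
    show "(\<Sum>i=1..card W. measure S {v i}) = 1"
      using sum[of UNIV] prob_space sets_eq_imp_space_eq[OF S(2)] by simp
    show "measure S A = (\<Sum>i=1..card W. measure S {v i} * measure (return borel (v i)) A)"
      if "A \<in> sets borel" for A
      unfolding sum[OF that] using that by (simp add: measure_return)
    show "v i \<in> std_simplex" "measure S {v i} > 0" if "i \<in> {1..card W}" for i
      using vW[OF that] Wsimp by (auto simp: W_def)
  qed
qed

lemma (in prob_space) prob_component_eq:
  fixes Z :: "'a \<Rightarrow> real ^ 'n"
  assumes Z: "Z \<in> borel_measurable M"
    and same: "distr M borel (\<lambda>\<omega>. Z \<omega> $ i) = distr M borel (\<lambda>\<omega>. Z \<omega> $ j)" and A: "A \<in> sets borel"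
  shows "\<P>(\<omega> in M. Z \<omega> $ i \<in> A) = \<P>(\<omega> in M. Z \<omega> $ j \<in> A)"
proof -
  have "\<P>(\<omega> in M. Z \<omega> $ l \<in> A) = measure (distr M borel (\<lambda>\<omega>. Z \<omega> $ l)) A" for l
    using A borel_measurable_component[OF Z]
    by (subst measure_distr) (auto intro!: arg_cong[where f = prob])
  then show ?thesis using same by simp
qed

lemma borel_measurable_radius [measurable]:
  "radius \<in> borel_measurable (borel :: (real ^ 'm) measure)"
  unfolding radius_def[abs_def] by (intro borel_measurable_continuous_onI continuous_intros)

text \<open>The integrand is at most \<eta> off the bad event and at most 1 on it, which leaves the
  conditional probability of the bad event. Dropping the conditioning event from its numerator gives
  the quotient.\<close>

lemma (in prob_space) integral_angle_le:
  fixes X :: "'a \<Rightarrow> real ^ 'm" and h :: "real ^ 'm \<Rightarrow> real"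
  assumes X[measurable]: "X \<in> borel_measurable M" and h[measurable]: "h \<in> borel_measurable borel"
    and h0: "\<And>x. 0 \<le> h x" "\<And>x. h x \<le> 1" and \<eta>: "0 \<le> \<eta>"
    and pos: "\<P>(\<omega> in M. radius (X \<omega>) > r) > 0"
    and B: "Measurable.pred M B"
    and good: "\<And>\<omega>. \<omega> \<in> space M \<Longrightarrow> radius (X \<omega>) > r \<Longrightarrow> \<not> B \<omega> \<Longrightarrow> h (angle (X \<omega>)) \<le> \<eta>"
  shows "integral\<^sup>L (distr (uniform_measure M {\<omega> \<in> space M. radius (X \<omega>) > r}) borel (\<lambda>\<omega>. angle (X \<omega>))) h
    \<le> \<eta> + \<P>(\<omega> in M. B \<omega>) / \<P>(\<omega> in M. radius (X \<omega>) > r)"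
proof -
  define A where "A = {\<omega> \<in> space M. radius (X \<omega>) > r}"
  define BB where "BB = {\<omega> \<in> space M. B \<omega>}"
  have [measurable]: "angle \<in> borel_measurable (borel :: (real ^ 'm) measure)"
    unfolding angle_def[abs_def] by measurable
  have A[measurable]: "A \<in> events" unfolding A_def by measurable
  have BB[measurable]: "BB \<in> events" unfolding BB_def using B by measurable
  have eA: "emeasure M A \<noteq> 0" "emeasure M A \<noteq> \<infinity>"
    using pos by (auto simp: A_def emeasure_eq_measure)
  define U where "U = uniform_measure M A"
  interpret U: prob_space U unfolding U_def using eA by (rule prob_space_uniform_measure)
  have sU[measurable_cong]: "sets U = sets M" by (simp add: U_def)
  have "integral\<^sup>L (distr U borel (\<lambda>\<omega>. angle (X \<omega>))) h = U.expectation (\<lambda>\<omega>. h (angle (X \<omega>)))"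
    by (rule integral_distr) measurable
  also have "\<dots> \<le> \<eta> + U.prob BB"
  proof (rule U.integral_le_bad_event)
    show "AE \<omega> in U. 0 \<le> h (angle (X \<omega>)) \<and> h (angle (X \<omega>)) \<le> \<eta> + indicator BB \<omega>"
      unfolding U_def
    proof (rule AE_uniform_measureI[OF A], rule AE_I2, rule impI)
      fix \<omega> assume "\<omega> \<in> space M" "\<omega> \<in> A"
      then show "0 \<le> h (angle (X \<omega>)) \<and> h (angle (X \<omega>)) \<le> \<eta> + indicator BB \<omega>"
        using h0(1)[of "angle (X \<omega>)"] h0(2)[of "angle (X \<omega>)"] good[of \<omega>] \<eta>
        by (cases "B \<omega>") (auto simp: A_def BB_def)
    qed
  qed measurable
  also have "U.prob BB = prob (A \<inter> BB) / prob A"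
    unfolding U_def by (rule measure_uniform_measure[OF eA BB])
  also have "\<dots> \<le> prob BB / prob A"
    by (intro divide_right_mono finite_measure_mono) auto
  finally show ?thesis by (simp add: U_def A_def BB_def)
qed

text \<open>The bound rests on the assumption about left tails: for a symmetric heavy-tailed real
  variable, the network sending a number to its positive and negative parts produces two atoms from
  a single coordinate.\<close>

theorem proposition8:
  fixes M :: "'a measure"
    and Z :: "'a \<Rightarrow> real ^ 'n"
    and f :: "real ^ 'n \<Rightarrow> real ^ 'm"
    and \<xi> :: real
    and S :: "(real ^ 'm) measure"
  assumes "prob_space M"
    and "Z \<in> borel_measurable M"
    and "prob_space.indep_vars M (\<lambda>_. borel) (\<lambda>i \<omega>. Z \<omega> $ i) UNIV"
    and "\<And>i j. distr M borel (\<lambda>\<omega>. Z \<omega> $ i) = distr M borel (\<lambda>\<omega>. Z \<omega> $ j)"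
    and "\<And>i. heavy_tailed M (\<lambda>\<omega>. Z \<omega> $ i) \<xi>"
    and "\<And>i. negligible_left_tail M (\<lambda>\<omega>. Z \<omega> $ i)"
    and "relu_network f"
    and "\<And>z j. 0 \<le> f z $ j"
    and "mv_heavy_tailed M (\<lambda>\<omega>. f (Z \<omega>)) \<xi> S"
  shows "\<exists>n' (v :: nat \<Rightarrow> real ^ 'm) (p :: nat \<Rightarrow> real).
    n' \<le> CARD('n) \<and>
    (\<forall>i\<in>{1..n'}. v i \<in> std_simplex) \<and>
    (\<forall>i\<in>{1..n'}. p i > 0) \<and>
    (\<Sum>i=1..n'. p i) = 1 \<and>
    (\<forall>A\<in>sets borel. A \<subseteq> std_simplex \<longrightarrow>
      measure S A = (\<Sum>i=1..n'. p i * measure (return borel (v i)) A))"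
proof -
  interpret prob_space M by fact
  note Z[measurable] = assms(2)
  have Zi[measurable]: "(\<lambda>\<omega>. Z \<omega> $ i) \<in> borel_measurable M" for i
    by (rule borel_measurable_component[OF Z])
  from assms(7) obtain g :: "real ^ 'n \<Rightarrow> real ^ 'm" and L D where
    g: "0 \<le> L" "\<And>c x. c \<ge> 0 \<Longrightarrow> g (c *\<^sub>R x) = c *\<^sub>R g x"
      "\<And>x y. l1 (g x - g y) \<le> L * l1 (x - y)" "\<And>x. l1 (f x - g x) \<le> D"
    by (rule relu_network_homogeneous_approx) blast
  have fZ[measurable]: "(\<lambda>\<omega>. f (Z \<omega>)) \<in> borel_measurable M"
    by (rule measurable_compose[OF Z borel_measurable_continuous_onI[OF relu_network_continuous[OF assms(7)]]])
  have R[measurable]: "(\<lambda>\<omega>. radius (f (Z \<omega>))) \<in> borel_measurable M" by measurable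

  \<comment> \<open>The coordinates share one law, so the tails are read off from an arbitrary
    index.\<close>
  define i0 :: 'n where "i0 = undefined"
  define H where "H t = \<P>(\<omega> in M. Z \<omega> $ i0 > t)" for t
  define N where "N t = \<P>(\<omega> in M. Z \<omega> $ i0 < - t)" for t
  define K where "K t = \<P>(\<omega> in M. radius (f (Z \<omega>)) > t)" for t
  have H_eq: "\<P>(\<omega> in M. Z \<omega> $ i > t) = H t" and N_eq: "\<P>(\<omega> in M. Z \<omega> $ i < - t) = N t" for i t
    using prob_component_eq[OF Z assms(4), of "{t<..}" i i0]
      prob_component_eq[OF Z assms(4), of "{..<-t}" i i0] by (simp_all add: H_def N_def)
  have "regularly_varying M (\<lambda>\<omega>. Z \<omega> $ i0) (1 / \<xi>)"
    using assms(5) unfolding heavy_tailed_def by blast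
  note Htail = regularly_varying_tail[OF Zi this, folded H_def]
  have "regularly_varying M (\<lambda>\<omega>. radius (f (Z \<omega>))) (1 / \<xi>)"
    using assms(9) unfolding mv_heavy_tailed_def heavy_tailed_def by blast
  note Ktail = regularly_varying_tail[OF R this, folded K_def]
  have NH: "((\<lambda>t. N t / H t) \<longlongrightarrow> 0) at_top"
    using assms(6)[of i0] unfolding negligible_left_tail_def N_def H_def .
  have H1: "H t \<le> 1" for t unfolding H_def by simp
  have N0: "0 \<le> N t" for t unfolding N_def by simp
  note negligible = tails_negligible[OF Htail(3) H1 Ktail(3,2) Htail(1) Htail(4) Ktail(4) NH]
  have S: "prob_space S" "sets S = sets borel" "measure S std_simplex = 1"
    and weak: "\<And>h :: real ^ 'm \<Rightarrow> real. continuous_on UNIV h \<Longrightarrow> bounded (range h) \<Longrightarrow>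
      ((\<lambda>r. integral\<^sup>L (distr (uniform_measure M {\<omega> \<in> space M. radius (f (Z \<omega>)) > r}) borel
        (\<lambda>\<omega>. angle (f (Z \<omega>)))) h) \<longlongrightarrow> integral\<^sup>L S h) at_top"
    using assms(9) unfolding mv_heavy_tailed_def angular_measure_def weakly_converges_def by blast+

  \<comment> \<open>If no positive semi-axis contributes to the radius, the conditioning event may be driven by the
    left tails of the coordinates, and the negative semi-axes supply the atoms instead.\<close>
  define \<sigma> :: real where "\<sigma> = (if \<exists>i. radius (g (axis i 1)) > 0 then 1 else -1)"
  have \<sigma>: "\<sigma> = 1 \<or> \<sigma> = -1 \<and> (\<forall>i. radius (g (axis i 1)) \<le> 0)"
    by (auto simp: \<sigma>_def not_less)
  \<comment> \<open>A contributing positive semi-axis makes \<open>K\<close> dominate a multiple of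
    \<open>H (C * r)\<close>. The left tails are then negligible against \<open>K\<close>, not only
    against \<open>H\<close>.\<close>
  have left: "((\<lambda>r. N (\<epsilon> * r) / K r) \<longlongrightarrow> 0) at_top" if "\<sigma> = 1" "0 < \<epsilon>" "\<epsilon> \<le> 1" for \<epsilon>
  proof -
    have "\<exists>i. radius (g (axis i 1)) > 0" using that by (auto simp: \<sigma>_def split: if_splits)
    then obtain i where "radius (g (axis i 1)) > 0" by blast
    from tail_lower_bound[OF Z assms(3) R g this] obtain C c where "C \<ge> 1" "c > 0"
      "\<forall>\<^sub>F r in at_top. c * H (C * r) \<le> K r" unfolding H_eq K_def by blast
    then show ?thesis using that N0 by (intro negligible(2))
  qed

  \<comment> \<open>The candidates may coincide or leave the simplex: where \<open>g\<close> has
    radius 0, division by zero yields the zero vector. Candidates outside the simplex receive no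
    mass.\<close>
  define v where "v i = angle (g (\<sigma> *\<^sub>R axis i 1))" for i
  \<comment> \<open>A bounded continuous test function vanishing exactly at the candidates.
    Truncating each factor at 1 bounds the product by any single factor.\<close>
  define h where "h x = (\<Prod>i\<in>UNIV. min 1 (dist x (v i)))" for x
  have h0: "0 \<le> h x" "h x \<le> 1" for x
    unfolding h_def by (auto intro!: prod_nonneg prod_le_1)
  have h_near: "h x \<le> \<eta>" if "dist x (v i) \<le> \<eta>" for x i \<eta>
  proof -
    have "h x = min 1 (dist x (v i)) * (\<Prod>j\<in>UNIV - {i}. min 1 (dist x (v j)))"
      unfolding h_def by (rule prod.remove) auto
    also have "\<dots> \<le> min 1 (dist x (v i)) * 1"
      by (intro mult_left_mono prod_le_1) auto
    finally show ?thesis using that by simp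
  qed
  have h_cont: "continuous_on UNIV h"
    unfolding h_def[abs_def] by (intro continuous_intros)
  then have h_meas[measurable]: "h \<in> borel_measurable borel" by (rule borel_measurable_continuous_onI)
  have h_bdd: "bounded (range h)" using h0 by (auto intro!: boundedI[of _ 1])

  \<comment> \<open>\<open>r\<close> tends to infinity for fixed \<eta>, and \<eta> tends to 0 only
    afterwards.\<close>
  have "integral\<^sup>L S h \<le> \<eta>" if \<eta>: "\<eta> > 0" for \<eta>
  proof -
    from angle_near_axis_image[OF g \<sigma> \<eta>] obtain \<epsilon> r0 where \<epsilon>: "0 < \<epsilon>" "\<epsilon> \<le> 1" and
      near: "\<And>r z. r \<ge> r0 \<Longrightarrow> radius (f z) > r \<Longrightarrow>
        \<forall>i j. i \<noteq> j \<longrightarrow> \<not> (\<bar>z $ i\<bar> > \<epsilon> * r \<and> \<bar>z $ j\<bar> > \<epsilon> * r) \<Longrightarrow>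
        \<sigma> = 1 \<longrightarrow> (\<forall>i. - (\<epsilon> * r) \<le> z $ i) \<Longrightarrow> \<exists>i. dist (angle (f z)) (v i) \<le> \<eta>"
      unfolding v_def by metis
    define two where "two r \<omega> \<longleftrightarrow> (\<exists>i j. i \<noteq> j \<and> \<bar>Z \<omega> $ i\<bar> > \<epsilon> * r \<and> \<bar>Z \<omega> $ j\<bar> > \<epsilon> * r)" for r \<omega>
    \<comment> \<open>For \<sigma> = -1 negative coordinates are no obstacle and this event is
      empty; the left tails then enter only through the squared term of \<open>b\<close>.\<close>
    define neg where "neg r \<omega> \<longleftrightarrow> \<sigma> = 1 \<and> (\<exists>i. Z \<omega> $ i < - (\<epsilon> * r))" for r \<omega>
    have [measurable]: "Measurable.pred M (two r)" "Measurable.pred M (neg r)" for r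
      unfolding two_def[abs_def] neg_def[abs_def] by measurable
    let ?n = "real CARD('n)"
    define b where "b r = ?n\<^sup>2 * (H (\<epsilon> * r) + N (\<epsilon> * r))\<^sup>2 +
      (if \<sigma> = 1 then ?n * N (\<epsilon> * r) else 0)" for r
    have b: "\<P>(\<omega> in M. two r \<omega> \<or> neg r \<omega>) \<le> b r" for r
    proof -
      have "\<P>(\<omega> in M. two r \<omega> \<or> neg r \<omega>) \<le> prob ({\<omega> \<in> space M. two r \<omega>} \<union> {\<omega> \<in> space M. neg r \<omega>})"
        by (intro finite_measure_mono) auto
      also have "\<dots> \<le> \<P>(\<omega> in M. two r \<omega>) + \<P>(\<omega> in M. neg r \<omega>)"
        by (rule measure_Un_le) auto
      also have "\<dots> \<le> b r"
        using bad_event_bound[OF Z assms(3) H_eq N_eq, of "\<epsilon> * r"]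
        unfolding b_def two_def neg_def by (intro add_mono) auto
      finally show ?thesis .
    qed
    have "((\<lambda>r. b r / K r) \<longlongrightarrow> 0) at_top"
    proof (cases "\<sigma> = 1")
      case True
      have "((\<lambda>r. ?n\<^sup>2 * ((H (\<epsilon> * r) + N (\<epsilon> * r))\<^sup>2 / K r) + ?n * (N (\<epsilon> * r) / K r)) \<longlongrightarrow>
          ?n\<^sup>2 * 0 + ?n * 0) at_top"
        by (intro tendsto_intros negligible(1) left \<epsilon> True)
      then show ?thesis using True by (simp add: b_def add_divide_distrib)
    next
      case False
      have "((\<lambda>r. ?n\<^sup>2 * ((H (\<epsilon> * r) + N (\<epsilon> * r))\<^sup>2 / K r)) \<longlongrightarrow> ?n\<^sup>2 * 0) at_top"
        by (intro tendsto_intros negligible(1) \<epsilon>)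
      then show ?thesis using False by (simp add: b_def)
    qed
    then have lim: "((\<lambda>r. \<eta> + b r / K r) \<longlongrightarrow> \<eta> + 0) at_top" by (intro tendsto_intros)
    have "\<forall>\<^sub>F r in at_top. integral\<^sup>L (distr (uniform_measure M {\<omega> \<in> space M. radius (f (Z \<omega>)) > r}) borel
        (\<lambda>\<omega>. angle (f (Z \<omega>)))) h \<le> \<eta> + b r / K r"
      using eventually_ge_at_top[of r0]
    proof eventually_elim
      case (elim r)
      have "integral\<^sup>L (distr (uniform_measure M {\<omega> \<in> space M. radius (f (Z \<omega>)) > r}) borel
          (\<lambda>\<omega>. angle (f (Z \<omega>)))) h \<le> \<eta> + \<P>(\<omega> in M. two r \<omega> \<or> neg r \<omega>) / K r"
        unfolding K_def
      proof (rule integral_angle_le[OF fZ h_meas h0])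
        show "h (angle (f (Z \<omega>))) \<le> \<eta>" if "radius (f (Z \<omega>)) > r" "\<not> (two r \<omega> \<or> neg r \<omega>)" for \<omega>
        proof -
          have "\<exists>i. dist (angle (f (Z \<omega>))) (v i) \<le> \<eta>"
            using that by (intro near[OF elim]) (auto simp: two_def neg_def not_less)
          then show ?thesis using h_near by blast
        qed
      qed (use \<eta> Ktail(3) in \<open>simp_all add: K_def\<close>)
      also have "\<dots> \<le> \<eta> + b r / K r"
        using b Ktail(3)[of r] by (intro add_left_mono divide_right_mono) auto
      finally show ?case .
    qed
    \<comment> \<open>Weak convergence passes the bound on the conditional integrals to the integral
      of \<open>h\<close> under \<open>S\<close>.\<close>
    then show ?thesis using tendsto_le[OF _ lim weak[OF h_cont h_bdd]] by simp
  qed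
  then have "integral\<^sup>L S h \<le> 0" by (rule field_le_epsilon) auto
  interpret S: prob_space S by fact
  have [measurable_cong]: "sets S = sets borel" by fact
  have "integral\<^sup>L S h = 0"
    using \<open>integral\<^sup>L S h \<le> 0\<close> h0 by (intro antisym integral_nonneg_AE) auto
  moreover have "integrable S h"
    using h0 by (intro S.integrable_const_bound[of _ 1]) auto
  ultimately have "AE x in S. h x = 0"
    using h0 by (subst (asm) integral_nonneg_eq_0_iff_AE) auto
  \<comment> \<open>A vanishing product has a vanishing factor, that is, a candidate at distance
    0.\<close>
  then have "AE x in S. x \<in> range v"
    by eventually_elim (auto simp: h_def min_def split: if_splits)
  moreover have "finite (range v)" by simp
  ultimately obtain n' w p where n': "n' \<le> card (range v)"
    and w: "\<forall>i\<in>{1..n'}. w i \<in> std_simplex" "\<forall>i\<in>{1..n'}. p i > 0" "(\<Sum>i=1..n'. p i) = 1"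
      "\<forall>A\<in>sets borel. measure S A = (\<Sum>i=1..n'. p i * measure (return borel (w i)) A)"
    using finite_support_decomposition[OF S, of "range v"] by blast
  \<comment> \<open>Coinciding candidates only lower the count.\<close>
  have "n' \<le> CARD('n)"
    using n' card_image_le[of UNIV v] by simp
  with w show ?thesis by blast
qed

end
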